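(* Let $k_1,k_2,k_3>0$ with $k_1k_2k_3=1$, let $\Gamma:=\Gamma(k_1,k_2,k_3)=\langle \iota_1,\iota_2,\iota_3 \mid \iota_1^2=\iota_2^2=\iota_3^2=\mathrm{Id}\rangle$ be the corresponding Weierstrass group, and let $\mathcal{T}$ be the triangulation of $\mathbb{H}^2$ obtained by taking the translates of the fundamental triangle $\triangle_0:=(\infty,-1,0)$ by $\Gamma$. Let $(a,b,c)=g\cdot\triangle_0$ be a level $n$ triangle, where $g\in\Gamma$ is a word of reduced word length $n$ in $\iota_1,\iota_2,\iota_3$, and $a=g(\infty)$, $b=g(-1)$, $c=g(0)$. Let $T_1,T_2,T_3$ be the triangles of $\mathcal{T}$ adjacent to $(a,b,c)$, where $T_i$ shares with $(a,b,c)$ the side marked by $k_i$ (so $T_1,T_2,T_3$ share the sides $[a,b]$, $[b,c]$, $[c,a]$ respectively). Then $$T_1=\left(b,\ a,\ \frac{k_1b(c-a)+a(c-b)}{k_1(c-a)+(c-b)}\right),$$ $$T_2=\left(\frac{k_2c(a-b)+b(a-c)}{k_2(a-b)+(a-c)},\ c,\ b\right),$$ $$T_3=\left(c,\ \frac{k_3a(b-c)+c(b-a)}{k_3(b-c)+(b-a)},\ a\right),$$ where, if one of $a,b,c$ is $\infty$, the formulas are interpreted by taking limits.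
   Context: $\mathbb{H}^2$ is the upper half plane, with $\mathrm{PSL}(2,\mathbb{R})$ acting by Möbius transformations. For $k_1,k_2,k_3>0$ with $k_1k_2k_3=1$, the Weierstrass group $\Gamma(k_1,k_2,k_3)<\mathrm{PSL}(2,\mathbb{R})$ is the group generated by the three involutions $$\iota_1=\frac{1}{\sqrt{k_1}}\begin{pmatrix}k_1&1+k_1\\-k_1&-k_1\end{pmatrix},\quad \iota_2=\frac{1}{\sqrt{k_2}}\begin{pmatrix}1&1\\-(k_2+1)&-1\end{pmatrix},\quad \iota_3=\frac{1}{\sqrt{k_3}}\begin{pmatrix}0&k_3\\-1&0\end{pmatrix}.$$ These are the $\pi$-rotations about the points $x_1=-1+\frac{i}{\sqrt{k_1}}$, $x_2=\frac{-1+\sqrt{k_2}\,i}{1+k_2}$, $x_3=\sqrt{k_3}\,i$ on the sides $[\infty,-1]$, $[-1,0]$, $[0,\infty]$ of the ideal triangle $\triangle_0=(\infty,-1,0)$ respectively. The group is the free product of the three groups of order two generated by the $\iota_i$, and $\triangle_0$ is a fundamental domain for it. The sides $[\infty,-1]$, $[-1,0]$, $[0,\infty]$ of $\triangle_0$ are marked by $k_1,k_2,k_3$ respectively, and this marking is transported to all triangles of $\mathcal{T}$ by $\Gamma$. A triangle of $\mathcal{T}$ is written as the ordered triple $(h(\infty),h(-1),h(0))$ with $h\in\Gamma$ the unique element such that the triangle is $h\cdot\triangle_0$; the equalities in the claim are equalities of ordered triples. *)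

theory Defs
  imports "HOL-Analysis.Analysis" "HOL-Algebra.Algebra"
begin

text \<open>
  \<open>PSL(2,R)\<close> is the quotient of the matrix group \<open>SL(2,R)\<close> by \<open>{I, -I}\<close>, so that its elements
  are cosets \<open>{A, -A}\<close>.
\<close>

definition SL2R :: "(real^2^2) monoid" where
  "SL2R = \<lparr>carrier = {A. det A = 1}, mult = (**), one = mat 1\<rparr>"

definition PSL2R :: "(real^2^2) set monoid" where
  "PSL2R = SL2R Mod {mat 1, - mat 1}"

definition psl :: "real^2^2 \<Rightarrow> (real^2^2) set" where
  "psl A = {mat 1, - mat 1} #>\<^bsub>SL2R\<^esub> A"

definition upper_half_plane :: "complex set" where
  "upper_half_plane = {z. Im z > 0}"

text \<open>The boundary at infinity of the upper half plane is the real projective line.\<close>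

datatype ideal_point = Pt real | Infty

definition ext_quot :: "real \<Rightarrow> real \<Rightarrow> ideal_point" where
  "ext_quot p q = (if q = 0 then Infty else Pt (p / q))"

definition mat_plane :: "real^2^2 \<Rightarrow> complex \<Rightarrow> complex" where
  "mat_plane A z = moebius (of_real (A$1$1)) (of_real (A$1$2)) (of_real (A$2$1)) (of_real (A$2$2)) z"

fun mat_ideal :: "real^2^2 \<Rightarrow> ideal_point \<Rightarrow> ideal_point" where
  "mat_ideal A (Pt x) = ext_quot (A$1$1 * x + A$1$2) (A$2$1 * x + A$2$2)"
| "mat_ideal A Infty = ext_quot (A$1$1) (A$2$1)"

text \<open>
  The matrices \<open>A\<close> and \<open>-A\<close> act in the same way, so the images below are singletons when
  \<open>g\<close> is an element of \<open>PSL(2,R)\<close>.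
\<close>

definition act_plane :: "(real^2^2) set \<Rightarrow> complex \<Rightarrow> complex" where
  "act_plane g z = the_elem ((\<lambda>A. mat_plane A z) ` g)"

definition act_ideal :: "(real^2^2) set \<Rightarrow> ideal_point \<Rightarrow> ideal_point" where
  "act_ideal g x = the_elem ((\<lambda>A. mat_ideal A x) ` g)"

text \<open>The parameters \<open>k\<^sub>1, k\<^sub>2, k\<^sub>3\<close> are the components of a vector \<open>k\<close>.\<close>

definition iota_mat :: "real^3 \<Rightarrow> 3 \<Rightarrow> real^2^2" where
  "iota_mat k i = (1 / sqrt (k$i)) *\<^sub>R
     (if i = 1 then vector [vector [k$1, 1 + k$1], vector [- k$1, - k$1]]
      else if i = 2 then vector [vector [1, 1], vector [- (k$2 + 1), - 1]]
      else vector [vector [0, k$3], vector [- 1, 0]])"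

definition iota :: "real^3 \<Rightarrow> 3 \<Rightarrow> (real^2^2) set" where
  "iota k i = psl (iota_mat k i)"

definition weierstrass_group :: "real^3 \<Rightarrow> (real^2^2) set set" where
  "weierstrass_group k = generate PSL2R (range (iota k))"

definition word_value :: "real^3 \<Rightarrow> 3 list \<Rightarrow> (real^2^2) set" where
  "word_value k w = foldr (\<lambda>i h. iota k i \<otimes>\<^bsub>PSL2R\<^esub> h) w \<one>\<^bsub>PSL2R\<^esub>"

text \<open>Since the generators are involutions, a word is reduced iff no two consecutive letters agree.\<close>

definition has_reduced_length :: "real^3 \<Rightarrow> (real^2^2) set \<Rightarrow> nat \<Rightarrow> bool" where
  "has_reduced_length k g n \<longleftrightarrow> (\<exists>w. distinct_adj w \<and> length w = n \<and> word_value k w = g)"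

text \<open>
  \<open>geodesic p q\<close> is the complete hyperbolic geodesic with distinct endpoints \<open>p\<close> and \<open>q\<close>
  (and is empty if \<open>p = q\<close>).
\<close>

fun geodesic :: "ideal_point \<Rightarrow> ideal_point \<Rightarrow> complex set" where
  "geodesic (Pt s) (Pt t) =
     {z \<in> upper_half_plane. cmod (z - of_real ((s + t) / 2)) = \<bar>s - t\<bar> / 2}"
| "geodesic (Pt s) Infty = {z \<in> upper_half_plane. Re z = s}"
| "geodesic Infty (Pt t) = {z \<in> upper_half_plane. Re z = t}"
| "geodesic Infty Infty = {}"

definition triangle0 :: "complex set" where
  "triangle0 = {z \<in> upper_half_plane. - 1 \<le> Re z \<and> Re z \<le> 0 \<and> cmod (z + 1/2) \<ge> 1/2}"

definition side0 :: "3 \<Rightarrow> complex set" where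
  "side0 i = (if i = 1 then geodesic Infty (Pt (- 1))
              else if i = 2 then geodesic (Pt (- 1)) (Pt 0)
              else geodesic (Pt 0) Infty)"

definition translate :: "(real^2^2) set \<Rightarrow> complex set \<Rightarrow> complex set" where
  "translate h S = act_plane h ` S"

definition triangulation :: "real^3 \<Rightarrow> complex set set" where
  "triangulation k = {translate h triangle0 | h. h \<in> weierstrass_group k}"

definition sides :: "real^3 \<Rightarrow> complex set \<Rightarrow> complex set set" where
  "sides k T = {translate h (side0 i) | h i. h \<in> weierstrass_group k \<and> T = translate h triangle0}"

text \<open>
  A side is marked by the label \<open>i\<close> rather than by the real number \<open>k$i\<close>, because the three
  numbers need not be distinct.
\<close>

definition marked :: "real^3 \<Rightarrow> complex set \<Rightarrow> 3 \<Rightarrow> bool" where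
  "marked k s i \<longleftrightarrow> (\<exists>h \<in> weierstrass_group k. s = translate h (side0 i))"

definition adjacent_across :: "real^3 \<Rightarrow> 3 \<Rightarrow> complex set \<Rightarrow> complex set \<Rightarrow> bool" where
  "adjacent_across k i T T' \<longleftrightarrow>
     T \<in> triangulation k \<and> T' \<in> triangulation k \<and> T \<noteq> T' \<and>
     (\<exists>s. s \<in> sides k T \<and> s \<in> sides k T' \<and> marked k s i)"

definition vertices :: "real^3 \<Rightarrow> complex set \<Rightarrow> ideal_point \<times> ideal_point \<times> ideal_point" where
  "vertices k T =
     (let h = (THE h. h \<in> weierstrass_group k \<and> T = translate h triangle0)
      in (act_ideal h Infty, act_ideal h (Pt (- 1)), act_ideal h (Pt 0)))"

fun tendsto_ideal :: "('a \<Rightarrow> real) \<Rightarrow> ideal_point \<Rightarrow> 'a filter \<Rightarrow> bool" where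
  "tendsto_ideal f (Pt l) F \<longleftrightarrow> (f \<longlongrightarrow> l) F"
| "tendsto_ideal f Infty F \<longleftrightarrow> filterlim f at_infinity F"

text \<open>
  \<open>frac_value N D a b c v\<close>: the fraction \<open>N(a,b,c) / D(a,b,c)\<close> has the value \<open>v\<close> in the projective
  line. For finite arguments a nonzero number over zero is \<open>\<infinity>\<close>, while \<open>0/0\<close> has no value; if
  one argument is \<open>\<infinity>\<close>, the value is the limit as that argument tends to \<open>\<infinity>\<close> (from both ends
  of the real line) with the other two held fixed.
\<close>

fun frac_value ::
  "(real \<Rightarrow> real \<Rightarrow> real \<Rightarrow> real) \<Rightarrow> (real \<Rightarrow> real \<Rightarrow> real \<Rightarrow> real) \<Rightarrow>
   ideal_point \<Rightarrow> ideal_point \<Rightarrow> ideal_point \<Rightarrow> ideal_point \<Rightarrow> bool" where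
  "frac_value N D (Pt a) (Pt b) (Pt c) v \<longleftrightarrow>
     (N a b c \<noteq> 0 \<or> D a b c \<noteq> 0) \<and> v = ext_quot (N a b c) (D a b c)"
| "frac_value N D Infty (Pt b) (Pt c) v \<longleftrightarrow> tendsto_ideal (\<lambda>x. N x b c / D x b c) v at_infinity"
| "frac_value N D (Pt a) Infty (Pt c) v \<longleftrightarrow> tendsto_ideal (\<lambda>x. N a x c / D a x c) v at_infinity"
| "frac_value N D (Pt a) (Pt b) Infty v \<longleftrightarrow> tendsto_ideal (\<lambda>x. N a b x / D a b x) v at_infinity"
| "frac_value N D _ _ _ v \<longleftrightarrow> False"

end

theory Submission
  imports Defs
begin

text \<open>
  The involution \<open>\<iota>\<^sub>i\<close> swaps the open half plane beyond the \<open>i\<close>-th side of the fundamental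
  triangle with the open half plane on the near side, and the three closed half planes beyond
  the sides are disjoint. By ping-pong, a nonempty reduced word beginning with \<open>\<iota>\<^sub>i\<close> moves the triangle
  beyond (or onto) the side \<open>i\<close>, and strictly beyond it if the word has length at least two. Hence
  triangles correspond bijectively to group elements, and \<open>g\<triangle>\<^sub>0\<close> shares a side marked \<open>k\<^sub>i\<close>
  only with \<open>g\<iota>\<^sub>i\<triangle>\<^sub>0\<close>. Two of the vertices of the latter are vertices of \<open>g\<triangle>\<^sub>0\<close>, and the third is the
  image under \<open>g\<close> of an explicit point, which homogeneous coordinates express through \<open>a, b, c\<close>.
\<close>

subsection \<open>The group \<open>PSL(2,R)\<close> and its actions\<close>

lemma matrix_mult_2:
  fixes A B :: "'a::semiring_1^2^2"
  shows "(A ** B) $ i $ j = A$i$1 * B$1$j + A$i$2 * B$2$j"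
  by (simp add: matrix_matrix_mult_def sum_2)

lemma mat_1_2:
  "(mat 1 :: 'a::semiring_1^2^2)$1$1 = 1" "(mat 1 :: 'a^2^2)$1$2 = 0"
  "(mat 1 :: 'a^2^2)$2$1 = 0" "(mat 1 :: 'a^2^2)$2$2 = 1"
  by (simp_all add: mat_def)

lemma group_SL2R: "group SL2R"
proof (rule groupI)
  fix A assume "A \<in> carrier SL2R"
  then have "det A = 1" by (simp add: SL2R_def)
  then obtain B where B: "B ** A = mat 1"
    by (metis invertible_det_nz invertible_left_inverse zero_neq_one)
  with \<open>det A = 1\<close> have "det B = 1"
    by (metis det_I det_mul mult.right_neutral)
  with B show "\<exists>B\<in>carrier SL2R. B \<otimes>\<^bsub>SL2R\<^esub> A = \<one>\<^bsub>SL2R\<^esub>"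
    by (auto simp: SL2R_def)
qed (auto simp: SL2R_def det_mul matrix_mul_assoc)

lemma minus_matrix_mult_2:
  fixes A B :: "real^2^2"
  shows "(- A) ** B = - (A ** B)" "A ** (- B) = - (A ** B)"
  by (simp_all add: vec_eq_iff matrix_mult_2)

lemma det_minus_2: "det (- A) = det (A :: real^2^2)"
  by (simp add: det_2)

text \<open>The matrix \<open>- mat 1\<close> is its own inverse and commutes with every matrix, so
  left and right cosets of the pair agree.\<close>

lemma normal_pm_one: "{mat 1, - mat 1} \<lhd> SL2R"
proof -
  interpret group SL2R by (rule group_SL2R)
  have minus_one: "- mat 1 \<in> carrier SL2R"
    by (simp add: SL2R_def det_minus_2)
  have sq: "- mat 1 \<otimes>\<^bsub>SL2R\<^esub> - mat 1 = \<one>\<^bsub>SL2R\<^esub>"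
    by (simp add: SL2R_def minus_matrix_mult_2)
  have "inv\<^bsub>SL2R\<^esub> (- mat 1) = - mat 1"
    using inv_equality[OF sq minus_one minus_one] .
  moreover have one: "\<one>\<^bsub>SL2R\<^esub> = mat 1"
    by (simp add: SL2R_def)
  moreover have "inv\<^bsub>SL2R\<^esub> (mat 1) = mat 1"
    using inv_one one by simp
  ultimately have "subgroup {mat 1, - mat 1} SL2R"
    using minus_one sq one by (intro subgroupI) (auto simp: SL2R_def minus_matrix_mult_2)
  then show ?thesis
    by (rule normalI) (auto simp: r_coset_def l_coset_def SL2R_def minus_matrix_mult_2)
qed

interpretation PSL2R: group PSL2R
  unfolding PSL2R_def by (rule normal.factorgroup_is_group[OF normal_pm_one])

lemma psl_eq: "psl A = {A, - A}"
  by (auto simp: psl_def r_coset_def SL2R_def minus_matrix_mult_2)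

lemma carrier_PSL2R: "carrier PSL2R = psl ` {A. det A = 1}"
  unfolding PSL2R_def carrier_FactGroup by (simp add: psl_def[abs_def] SL2R_def)

lemma psl_in_carrier: "det A = 1 \<Longrightarrow> psl A \<in> carrier PSL2R"
  by (simp add: carrier_PSL2R)

lemma psl_mult:
  assumes "det A = 1" "det B = 1"
  shows "psl A \<otimes>\<^bsub>PSL2R\<^esub> psl B = psl (A ** B)"
proof -
  have "A \<in> carrier SL2R" "B \<in> carrier SL2R" "A ** B = A \<otimes>\<^bsub>SL2R\<^esub> B"
    using assms by (simp_all add: SL2R_def)
  then show ?thesis
    using normal.rcos_sum[OF normal_pm_one] by (simp add: PSL2R_def psl_def)
qed

lemma one_PSL2R: "\<one>\<^bsub>PSL2R\<^esub> = psl (mat 1)"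
  by (simp add: PSL2R_def psl_eq)

lemma psl_minus: "psl (- A) = psl A"
  by (auto simp: psl_eq)

section \<open>Moebius actions on the upper half plane and on its boundary\<close>

lemma act_plane_psl: "act_plane (psl A) z = mat_plane A z"
proof -
  have "mat_plane (- A) z = mat_plane A z"
    unfolding mat_plane_def moebius_def
    by (subst minus_divide_divide[symmetric]) (simp add: algebra_simps)
  then show ?thesis by (simp add: act_plane_def psl_eq)
qed

lemma ext_quot_scale: "r \<noteq> 0 \<Longrightarrow> ext_quot (r * p) (r * q) = ext_quot p q"
  by (simp add: ext_quot_def)

lemma ext_quot_minus: "ext_quot (- p) (- q) = ext_quot p q"
  using ext_quot_scale[of "-1"] by simp

text \<open>Homogeneous coordinates \<open>[x : 1]\<close> of a finite point and
  \<open>[1 : 0]\<close> of infinity; they turn the boundary action into one linear formula without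
  case split.\<close>

fun hom_num :: "ideal_point \<Rightarrow> real" where
  "hom_num (Pt x) = x"
| "hom_num Infty = 1"

fun hom_den :: "ideal_point \<Rightarrow> real" where
  "hom_den (Pt x) = 1"
| "hom_den Infty = 0"

lemma mat_ideal_hom:
  "mat_ideal A p = ext_quot (A$1$1 * hom_num p + A$1$2 * hom_den p) (A$2$1 * hom_num p + A$2$2 * hom_den p)"
  by (cases p) simp_all

text \<open>Homogeneous coordinates matter only up to a nonzero factor. The pair of zeros is
  excluded because \<open>ext_quot 0 0\<close> is \<open>Infty\<close> by default and represents no
  direction.\<close>

lemma mat_ideal_ext_quot:
  assumes "p \<noteq> 0 \<or> q \<noteq> 0"
  shows "mat_ideal A (ext_quot p q) = ext_quot (A$1$1 * p + A$1$2 * q) (A$2$1 * p + A$2$2 * q)"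
proof (cases "q = 0")
  case True
  with assms show ?thesis
    using ext_quot_scale[of p "A$1$1" "A$2$1"] by (simp add: ext_quot_def mult.commute)
next
  case False
  then show ?thesis
    using ext_quot_scale[of q "A$1$1 * (p / q) + A$1$2" "A$2$1 * (p / q) + A$2$2"]
    by (simp add: ext_quot_def[of p q] algebra_simps)
qed

lemma act_ideal_psl: "act_ideal (psl A) p = mat_ideal A p"
proof -
  have "mat_ideal (- A) p = mat_ideal A p"
    using ext_quot_minus[of "A$1$1 * hom_num p + A$1$2 * hom_den p" "A$2$1 * hom_num p + A$2$2 * hom_den p"]
    by (simp add: mat_ideal_hom algebra_simps)
  then show ?thesis by (simp add: act_ideal_def psl_eq)
qed

text \<open>If the denominator vanished, its imaginary part would force \<open>A$2$1 = 0\<close> and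
  then its real part \<open>A$2$2 = 0\<close>, against determinant one.\<close>

lemma moebius_denominator_nonzero:
  fixes A :: "real^2^2"
  assumes "det A = 1" "Im z > 0"
  shows "of_real (A$2$1) * z + of_real (A$2$2) \<noteq> (0::complex)"
proof
  assume "of_real (A$2$1) * z + of_real (A$2$2) = (0::complex)"
  then have "A$2$1 * Re z + A$2$2 = 0" "A$2$1 * Im z = 0"
    by (simp_all add: complex_eq_iff)
  with assms show False by (auto simp: det_2)
qed

lemma Im_mat_plane:
  assumes "det A = 1" "Im z > 0"
  shows "Im (mat_plane A z) > 0"
proof -
  let ?w = "of_real (A$2$1) * z + of_real (A$2$2) :: complex"
  \<comment> \<open>Multiplying by the conjugate of the denominator makes the denominator real, so
    only the imaginary part of the new numerator is needed.\<close>
  have "Im (mat_plane A z) = Im ((of_real (A$1$1) * z + of_real (A$1$2)) * cnj ?w) / (cmod ?w)\<^sup>2"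
    unfolding mat_plane_def moebius_def
    by (subst complex_div_cnj) (simp add: Im_divide_of_real flip: of_real_power)
  also have "Im ((of_real (A$1$1) * z + of_real (A$1$2)) * cnj ?w) = det A * Im z"
    by (simp add: det_2 algebra_simps)
  finally show ?thesis
    using assms moebius_denominator_nonzero[OF assms] by simp
qed

lemma mat_plane_mult:
  assumes "det A = 1" "det B = 1" "Im z > 0"
  shows "mat_plane (A ** B) z = mat_plane A (mat_plane B z)"
proof -
  have "of_real (B$2$1) * z + of_real (B$2$2) \<noteq> (0::complex)"
    by (rule moebius_denominator_nonzero) fact+
  moreover have "of_real (A$2$1) * mat_plane B z + of_real (A$2$2) \<noteq> (0::complex)"
    by (intro moebius_denominator_nonzero Im_mat_plane) fact+
  moreover have "of_real ((A ** B)$2$1) * z + of_real ((A ** B)$2$2) \<noteq> (0::complex)"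
    by (rule moebius_denominator_nonzero) (use assms in \<open>simp_all add: det_mul\<close>)
  ultimately show ?thesis
    by (simp add: mat_plane_def moebius_def matrix_mult_2 divide_simps) (simp add: algebra_simps)
qed

lemma act_plane_upper:
  assumes "h \<in> carrier PSL2R" "z \<in> upper_half_plane"
  shows "act_plane h z \<in> upper_half_plane"
  using assms by (auto simp: carrier_PSL2R act_plane_psl upper_half_plane_def Im_mat_plane)

lemma act_plane_mult:
  assumes "g \<in> carrier PSL2R" "h \<in> carrier PSL2R" "z \<in> upper_half_plane"
  shows "act_plane (g \<otimes>\<^bsub>PSL2R\<^esub> h) z = act_plane g (act_plane h z)"
  using assms
  by (auto simp: carrier_PSL2R psl_mult act_plane_psl upper_half_plane_def mat_plane_mult)

lemma act_plane_one: "act_plane \<one>\<^bsub>PSL2R\<^esub> z = z"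
  by (simp add: one_PSL2R act_plane_psl mat_plane_def moebius_def mat_1_2)

lemma act_ideal_mult:
  assumes "g \<in> carrier PSL2R" "h \<in> carrier PSL2R"
  shows "act_ideal (g \<otimes>\<^bsub>PSL2R\<^esub> h) p = act_ideal g (act_ideal h p)"
proof -
  obtain A B where AB: "det A = 1" "g = psl A" "det B = 1" "h = psl B"
    using assms by (auto simp: carrier_PSL2R)
  let ?P = "B$1$1 * hom_num p + B$1$2 * hom_den p" and ?Q = "B$2$1 * hom_num p + B$2$2 * hom_den p"
  \<comment> \<open>The adjugate of \<open>B\<close> recovers the coordinates of \<open>p\<close>
    from those of its image, so the image vector is nonzero.\<close>
  have "B$2$2 * ?P - B$1$2 * ?Q = det B * hom_num p" "B$1$1 * ?Q - B$2$1 * ?P = det B * hom_den p"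
    by (simp_all add: det_2 algebra_simps)
  moreover have "hom_num p \<noteq> 0 \<or> hom_den p \<noteq> 0"
    by (cases p) simp_all
  ultimately have "?P \<noteq> 0 \<or> ?Q \<noteq> 0"
    using AB(3) by force
  then have "mat_ideal A (mat_ideal B p) = mat_ideal (A ** B) p"
    unfolding mat_ideal_hom[of B p] mat_ideal_hom[of "A ** B" p]
    by (simp add: mat_ideal_ext_quot matrix_mult_2 algebra_simps)
  with AB show ?thesis
    by (simp add: psl_mult act_ideal_psl)
qed

section \<open>Translates of subsets of the upper half plane\<close>

lemma translate_mult:
  assumes "g \<in> carrier PSL2R" "h \<in> carrier PSL2R" "S \<subseteq> upper_half_plane"
  shows "translate (g \<otimes>\<^bsub>PSL2R\<^esub> h) S = translate g (translate h S)"
  using assms by (force simp: translate_def image_image intro!: image_cong act_plane_mult)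

lemma translate_one: "translate \<one>\<^bsub>PSL2R\<^esub> S = S"
  by (simp add: translate_def act_plane_one)

lemma translate_upper:
  assumes "h \<in> carrier PSL2R" "S \<subseteq> upper_half_plane"
  shows "translate h S \<subseteq> upper_half_plane"
  using assms by (auto simp: translate_def act_plane_upper)

lemma translate_inject:
  assumes "g \<in> carrier PSL2R" "S \<subseteq> upper_half_plane" "S' \<subseteq> upper_half_plane"
  shows "translate g S = translate g S' \<longleftrightarrow> S = S'"
proof
  have cancel: "translate (inv\<^bsub>PSL2R\<^esub> g) (translate g R) = R" if "R \<subseteq> upper_half_plane" for R
    using assms(1) that by (simp add: translate_one flip: translate_mult)
  assume "translate g S = translate g S'"
  then show "S = S'"
    using cancel[OF assms(2)] cancel[OF assms(3)] by metis
qed simp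

subsection \<open>Geodesics\<close>

text \<open>
  In homogeneous coordinates \<open>p = [p\<^sub>0 : p\<^sub>1]\<close>, \<open>q = [q\<^sub>0 : q\<^sub>1]\<close>, a Moebius map of determinant one
  multiplies \<open>p\<^sub>1 z - p\<^sub>0\<close> by the inverse of its denominator at \<open>z\<close>, so the quadratic equation below is preserved.
\<close>

lemma geodesic_ext_quot:
  assumes "p0 \<noteq> 0 \<or> p1 \<noteq> 0" "q0 \<noteq> 0 \<or> q1 \<noteq> 0"
  shows "geodesic (ext_quot p0 p1) (ext_quot q0 q1) =
    {z \<in> upper_half_plane. Re ((of_real p1 * z - of_real p0) * cnj (of_real q1 * z - of_real q0)) = 0}"
proof -
  \<comment> \<open>Thales: on the circle with diameter from \<open>s\<close> to \<open>t\<close>,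
    the vectors \<open>z - s\<close> and \<open>z - t\<close> are orthogonal. Both sides are
    nonnegative, so squares can be compared.\<close>
  have circle: "cmod (z - of_real ((s + t) / 2)) = \<bar>s - t\<bar> / 2 \<longleftrightarrow>
      (Re z - s) * (Re z - t) + Im z * Im z = 0" for z s t
  proof -
    have "cmod (z - of_real ((s + t) / 2)) = \<bar>s - t\<bar> / 2 \<longleftrightarrow>
        (cmod (z - of_real ((s + t) / 2)))\<^sup>2 = (\<bar>s - t\<bar> / 2)\<^sup>2"
      by (simp add: power2_eq_iff_nonneg)
    also have "\<dots> \<longleftrightarrow> (Re z - (s + t) / 2)\<^sup>2 + (Im z)\<^sup>2 = ((s - t) / 2)\<^sup>2"
      by (simp add: cmod_power2 power_divide)
    also have "\<dots> \<longleftrightarrow> (Re z - s) * (Re z - t) + Im z * Im z = 0"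
      by (auto simp: power2_eq_square field_simps)
    finally show ?thesis .
  qed
  have finite: "cmod (z - of_real ((p0 / p1 + q0 / q1) / 2)) = \<bar>p0 / p1 - q0 / q1\<bar> / 2 \<longleftrightarrow>
      (p1 * Re z - p0) * (q1 * Re z - q0) + p1 * Im z * (q1 * Im z) = 0"
    if nz: "p1 \<noteq> 0" "q1 \<noteq> 0" for z
  proof -
    have "(p1 * Re z - p0) * (q1 * Re z - q0) + p1 * Im z * (q1 * Im z) =
        p1 * q1 * ((Re z - p0 / p1) * (Re z - q0 / q1) + Im z * Im z)"
      using nz by (simp add: field_simps)
    with nz show ?thesis unfolding circle by simp
  qed
  show ?thesis
  proof (cases "p1 = 0"; cases "q1 = 0")
    assume "p1 \<noteq> 0" "q1 \<noteq> 0"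
    then have "geodesic (ext_quot p0 p1) (ext_quot q0 q1) =
        {z \<in> upper_half_plane. (p1 * Re z - p0) * (q1 * Re z - q0) + p1 * Im z * (q1 * Im z) = 0}"
      by (simp only: ext_quot_def if_False geodesic.simps finite not_False_eq_True)
    then show ?thesis by simp
  \<comment> \<open>An endpoint at infinity makes its factor a nonzero constant. One such endpoint
    leaves the equation of a vertical line; two leave no solution, matching the empty
    \<open>geodesic Infty Infty\<close>.\<close>
  qed (use assms in \<open>auto simp: ext_quot_def field_simps\<close>)
qed

lemma translate_geodesic_subset:
  assumes "h \<in> carrier PSL2R"
  shows "translate h (geodesic p q) \<subseteq> geodesic (act_ideal h p) (act_ideal h q)"
proof
  obtain A where A: "det A = 1" "h = psl A"
    using assms by (auto simp: carrier_PSL2R)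
  have hom: "hom_num r \<noteq> 0 \<or> hom_den r \<noteq> 0" "r = ext_quot (hom_num r) (hom_den r)" for r
    by (cases r; simp add: ext_quot_def)+
  let ?P = "\<lambda>r. A$1$1 * hom_num r + A$1$2 * hom_den r" and ?Q = "\<lambda>r. A$2$1 * hom_num r + A$2$2 * hom_den r"
  have nz: "?P r \<noteq> 0 \<or> ?Q r \<noteq> 0" for r
  proof -
    have "A$2$2 * ?P r - A$1$2 * ?Q r = det A * hom_num r" "A$1$1 * ?Q r - A$2$1 * ?P r = det A * hom_den r"
      by (simp_all add: det_2 algebra_simps)
    with hom(1)[of r] A(1) show ?thesis by force
  qed
  fix w assume "w \<in> translate h (geodesic p q)"
  then obtain z where z: "z \<in> geodesic p q" "w = mat_plane A z"
    by (auto simp: translate_def A act_plane_psl)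
  have "z \<in> geodesic (ext_quot (hom_num p) (hom_den p)) (ext_quot (hom_num q) (hom_den q))"
    using z hom(2) by metis
  then have zu: "z \<in> upper_half_plane" and
    zeq: "Re ((of_real (hom_den p) * z - of_real (hom_num p)) * cnj (of_real (hom_den q) * z - of_real (hom_num q))) = 0"
    using hom(1) by (auto simp: geodesic_ext_quot)
  define d where "d = of_real (A$2$1) * z + of_real (A$2$2)"
  have d: "d \<noteq> 0"
    using zu A moebius_denominator_nonzero by (auto simp: d_def upper_half_plane_def)
  \<comment> \<open>Both linear forms get divided by the same \<open>d\<close>, so the product of
    one with the conjugate of the other is divided by a positive real number, which does not affect
    the vanishing of the real part.\<close>
  have fac: "of_real (?Q r) * w - of_real (?P r) = (of_real (hom_den r) * z - of_real (hom_num r)) / d" for r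
  proof -
    have "of_real (?Q r) * (of_real (A$1$1) * z + of_real (A$1$2)) - of_real (?P r) * d =
        of_real (det A) * (of_real (hom_den r) * z - of_real (hom_num r))"
      by (simp add: d_def det_2 algebra_simps)
    with d A show ?thesis
      by (simp add: z(2) mat_plane_def moebius_def d_def field_simps)
  qed
  have "(of_real (?Q p) * w - of_real (?P p)) * cnj (of_real (?Q q) * w - of_real (?P q)) =
      ((of_real (hom_den p) * z - of_real (hom_num p)) * cnj (of_real (hom_den q) * z - of_real (hom_num q)))
       / of_real ((cmod d)\<^sup>2)"
    unfolding fac complex_norm_square by simp
  then have "Re ((of_real (?Q p) * w - of_real (?P p)) * cnj (of_real (?Q q) * w - of_real (?P q))) = 0"
    using zeq by (simp only: Re_divide_of_real div_0)
  moreover have "w \<in> upper_half_plane"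
    using zu A by (simp add: z(2) upper_half_plane_def Im_mat_plane)
  ultimately show "w \<in> geodesic (act_ideal h p) (act_ideal h q)"
    unfolding A(2) act_ideal_psl mat_ideal_hom using nz by (simp only: geodesic_ext_quot) simp
qed

lemma geodesic_upper: "geodesic p q \<subseteq> upper_half_plane"
  by (cases p; cases q) auto

lemma act_ideal_one: "act_ideal \<one>\<^bsub>PSL2R\<^esub> p = p"
  by (cases p) (simp_all add: one_PSL2R act_ideal_psl mat_1_2 ext_quot_def)

text \<open>The missing inclusion is the known one for the inverse of \<open>h\<close>, moved back
  by \<open>h\<close>.\<close>

lemma translate_geodesic:
  assumes h: "h \<in> carrier PSL2R"
  shows "translate h (geodesic p q) = geodesic (act_ideal h p) (act_ideal h q)"
proof
  let ?G = "geodesic (act_ideal h p) (act_ideal h q)"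
  have h': "inv\<^bsub>PSL2R\<^esub> h \<in> carrier PSL2R" using h by simp
  have "?G = translate h (translate (inv\<^bsub>PSL2R\<^esub> h) ?G)"
    using h h' by (simp add: geodesic_upper translate_one flip: translate_mult)
  also have "\<dots> \<subseteq> translate h (geodesic p q)"
    using translate_geodesic_subset[OF h', of "act_ideal h p" "act_ideal h q"] h h'
    unfolding act_ideal_mult[OF h' h, symmetric]
    by (simp add: act_ideal_one translate_def image_mono)
  finally show "?G \<subseteq> translate h (geodesic p q)" .
qed (rule translate_geodesic_subset[OF h])

subsection \<open>The third vertex\<close>

lemma tendsto_linear_fraction_at_infinity:
  fixes m n p q :: real
  assumes "p \<noteq> 0"
  shows "((\<lambda>x. (m * x + n) / (p * x + q)) \<longlongrightarrow> m / p) at_infinity"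
proof -
  have "((\<lambda>x. (m + n * inverse x) / (p + q * inverse x)) \<longlongrightarrow> (m + n * 0) / (p + q * 0)) at_infinity"
    using assms by (intro tendsto_intros tendsto_inverse_0) simp
  moreover have "\<forall>\<^sub>F x in at_infinity. (m + n * inverse x) / (p + q * inverse x) = (m * x + n) / (p * x + q)"
    unfolding eventually_at_infinity
  \<comment> \<open>The bound \<open>1\<close> keeps \<open>x\<close> away from \<open>0\<close>,
    where \<open>inverse x\<close> is \<open>0\<close> by default and the two expressions can
    differ.\<close>
  proof (intro exI[of _ 1] allI impI)
    fix x :: real assume "1 \<le> norm x"
    then have "x \<noteq> 0" by auto
    then show "(m + n * inverse x) / (p + q * inverse x) = (m * x + n) / (p * x + q)"
      using mult_divide_mult_cancel_left[of x "m + n * inverse x" "p + q * inverse x"]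
      by (simp add: algebra_simps)
  qed
  ultimately show ?thesis
    by (simp add: filterlim_cong)
qed

text \<open>Each clause of \<open>frac_value\<close> treats the three argument positions alike, so a
  cyclic relabelling only permutes the clauses.\<close>

lemma frac_value_rotate:
  "frac_value (\<lambda>a b c. N b c a) (\<lambda>a b c. D b c a) a b c v \<longleftrightarrow> frac_value N D b c a v"
  by (cases a; cases b; cases c) simp_all

text \<open>
  The second and third formula are the first one applied to \<open>(b, c, a)\<close> and \<open>(c, a, b)\<close>.
  Homogeneous coordinates of \<open>\<infinity>, -1, 0\<close> can be scaled so that the third vector is the sum of
  the first two, and linear maps and cyclic shifts (with sign changes) preserve this relation.
\<close>

lemma frac_value_cross:
  fixes \<kappa> :: real
  assumes det: "p0 * q1 - p1 * q0 \<noteq> 0" and pos: "\<kappa> > 0"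
  shows "frac_value (\<lambda>a b c. \<kappa> * b * (c - a) + a * (c - b)) (\<lambda>a b c. \<kappa> * (c - a) + (c - b))
    (ext_quot p0 p1) (ext_quot q0 q1) (ext_quot (p0 + q0) (p1 + q1))
    (ext_quot (p0 - \<kappa> * q0) (p1 - \<kappa> * q1))"
proof -
  let ?N = "\<lambda>a b c. \<kappa> * b * (c - a) + a * (c - b)" and ?D = "\<lambda>a b c. \<kappa> * (c - a) + (c - b)"
  \<comment> \<open>The cases are: first, second or third point infinite, or all finite. At most one
    point is infinite, because the three vectors are pairwise independent.\<close>
  consider "p1 = 0" | "q1 = 0" | "p1 + q1 = 0" "p1 \<noteq> 0" | "p1 \<noteq> 0" "q1 \<noteq> 0" "p1 + q1 \<noteq> 0"
    by blast
  then show ?thesis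
  proof cases
    case 1
    then have nz: "p0 \<noteq> 0" "q1 \<noteq> 0" using det by auto
    \<comment> \<open>Numerator and denominator are affine in the infinite argument, so the limit is
      the quotient of their leading coefficients; the same holds in the next two cases.\<close>
    have lim: "((\<lambda>x. ?N x b c / ?D x b c) \<longlongrightarrow> (- \<kappa> * b + (c - b)) / (- \<kappa>)) at_infinity" for b c
      using tendsto_linear_fraction_at_infinity[of "- \<kappa>" "- \<kappa> * b + (c - b)" "\<kappa> * b * c" "\<kappa> * c + (c - b)"] pos
      by (simp add: algebra_simps)
    have val: "(- \<kappa> * (q0 / q1) + ((p0 + q0) / q1 - q0 / q1)) / (- \<kappa>) = (p0 - \<kappa> * q0) / (p1 - \<kappa> * q1)"
      using 1 nz pos by (simp add: field_simps)
    have ext: "ext_quot p0 p1 = Infty" "ext_quot q0 q1 = Pt (q0 / q1)"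
        "ext_quot (p0 + q0) (p1 + q1) = Pt ((p0 + q0) / q1)"
        "ext_quot (p0 - \<kappa> * q0) (p1 - \<kappa> * q1) = Pt ((p0 - \<kappa> * q0) / (p1 - \<kappa> * q1))"
      using 1 nz pos by (simp_all add: ext_quot_def)
    show ?thesis
      unfolding ext frac_value.simps tendsto_ideal.simps val[symmetric] by (rule lim)
  next
    case 2
    then have nz: "q0 \<noteq> 0" "p1 \<noteq> 0" using det by auto
    have lim: "((\<lambda>x. ?N a x c / ?D a x c) \<longlongrightarrow> (\<kappa> * (c - a) - a) / (- 1)) at_infinity" for a c
      using tendsto_linear_fraction_at_infinity[of "- 1" "\<kappa> * (c - a) - a" "a * c" "\<kappa> * (c - a) + c"]
      by (simp add: algebra_simps)
    have val: "(\<kappa> * ((p0 + q0) / p1 - p0 / p1) - p0 / p1) / (- 1) = (p0 - \<kappa> * q0) / (p1 - \<kappa> * q1)"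
      using 2 nz by (simp add: field_simps)
    have ext: "ext_quot p0 p1 = Pt (p0 / p1)" "ext_quot q0 q1 = Infty"
        "ext_quot (p0 + q0) (p1 + q1) = Pt ((p0 + q0) / p1)"
        "ext_quot (p0 - \<kappa> * q0) (p1 - \<kappa> * q1) = Pt ((p0 - \<kappa> * q0) / (p1 - \<kappa> * q1))"
      using 2 nz by (simp_all add: ext_quot_def)
    show ?thesis
      unfolding ext frac_value.simps tendsto_ideal.simps val[symmetric] by (rule lim)
  next
    case 3
    then have q1: "q1 = - p1" by simp
    have lim: "((\<lambda>x. ?N a b x / ?D a b x) \<longlongrightarrow> (\<kappa> * b + a) / (\<kappa> + 1)) at_infinity" for a b
      using tendsto_linear_fraction_at_infinity[of "\<kappa> + 1" "\<kappa> * b + a" "- (\<kappa> * b * a) - a * b" "- \<kappa> * a - b"] pos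
      by (simp add: algebra_simps)
    have val: "(\<kappa> * (q0 / q1) + p0 / p1) / (\<kappa> + 1) = (p0 - \<kappa> * q0) / (p1 - \<kappa> * q1)"
    proof -
      have "p1 - \<kappa> * q1 = p1 * (\<kappa> + 1)" "\<kappa> * (q0 / q1) + p0 / p1 = (p0 - \<kappa> * q0) / p1"
        using 3 by (simp_all add: q1 field_simps)
      then show ?thesis by simp
    qed
    have "p1 - \<kappa> * q1 \<noteq> 0"
    proof -
      have "p1 - \<kappa> * q1 = p1 * (\<kappa> + 1)" by (simp add: q1 algebra_simps)
      then show ?thesis using 3 pos by simp
    qed
    then have ext: "ext_quot p0 p1 = Pt (p0 / p1)" "ext_quot q0 q1 = Pt (q0 / q1)"
        "ext_quot (p0 + q0) (p1 + q1) = Infty"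
        "ext_quot (p0 - \<kappa> * q0) (p1 - \<kappa> * q1) = Pt ((p0 - \<kappa> * q0) / (p1 - \<kappa> * q1))"
      using 3 q1 by (simp_all add: ext_quot_def)
    show ?thesis
      unfolding ext frac_value.simps tendsto_ideal.simps val[symmetric] by (rule lim)
  next
    case 4
    \<comment> \<open>The differences \<open>?c - ?a\<close> and \<open>?c - ?b\<close> are
      \<open>- q1\<close> and \<open>p1\<close> times this \<open>r\<close>; hence numerator and
      denominator are \<open>r\<close> times the coordinates of the claimed value.\<close>
    define r where "r = (p0 * q1 - p1 * q0) / (p1 * q1 * (p1 + q1))"
    have r: "r \<noteq> 0" using 4 det by (simp add: r_def)
    let ?a = "p0 / p1" and ?b = "q0 / q1" and ?c = "(p0 + q0) / (p1 + q1)"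
    have diff: "?c - ?a = - q1 * r" "?c - ?b = p1 * r"
    proof -
      define s where "s = p1 + q1"
      have "p1 \<noteq> 0" "q1 \<noteq> 0" "s \<noteq> 0"
        using 4 by (simp_all add: s_def)
      then have "(p0 + q0) / s - ?a = - q1 * r" "(p0 + q0) / s - ?b = p1 * r"
        unfolding r_def s_def[symmetric] by (simp_all add: field_simps) (simp_all add: s_def algebra_simps)
      then show "?c - ?a = - q1 * r" "?c - ?b = p1 * r"
        by (simp_all only: s_def)
    qed
    have N: "?N ?a ?b ?c = r * (p0 - \<kappa> * q0)" and D: "?D ?a ?b ?c = r * (p1 - \<kappa> * q1)"
      unfolding diff using 4 by (simp_all add: field_simps)
    \<comment> \<open>This rules out the undefined \<open>0/0\<close>: otherwise the two vectors
      would be proportional.\<close>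
    have "p0 - \<kappa> * q0 \<noteq> 0 \<or> p1 - \<kappa> * q1 \<noteq> 0"
    proof (rule ccontr)
      assume "\<not> ?thesis"
      then have "p0 = \<kappa> * q0" "p1 = \<kappa> * q1" by simp_all
      with det show False by simp
    qed
    moreover have "ext_quot p0 p1 = Pt ?a" "ext_quot q0 q1 = Pt ?b" "ext_quot (p0 + q0) (p1 + q1) = Pt ?c"
      using 4 by (simp_all add: ext_quot_def)
    ultimately show ?thesis
      using r by (simp only: frac_value.simps N D ext_quot_scale[OF r]) simp
  qed
qed

text \<open>For \<kappa> equal to \<open>k$i\<close>, the point to which \<open>A\<close> is applied
  in the i-th value is the image under the i-th involution of the vertex of the fundamental triangle
  off side i.\<close>

lemma frac_value_adjacent:
  fixes A :: "real^2^2" and \<kappa> :: real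
  assumes det: "det A = 1" and pos: "\<kappa> > 0"
  defines "a \<equiv> mat_ideal A Infty" and "b \<equiv> mat_ideal A (Pt (- 1))" and "c \<equiv> mat_ideal A (Pt 0)"
  shows "frac_value (\<lambda>a b c. \<kappa> * b * (c - a) + a * (c - b)) (\<lambda>a b c. \<kappa> * (c - a) + (c - b)) a b c
      (mat_ideal A (Pt (- (1 + \<kappa>) / \<kappa>)))"
    and "frac_value (\<lambda>a b c. \<kappa> * c * (a - b) + b * (a - c)) (\<lambda>a b c. \<kappa> * (a - b) + (a - c)) a b c
      (mat_ideal A (Pt (- 1 / (1 + \<kappa>))))"
    and "frac_value (\<lambda>a b c. \<kappa> * a * (b - c) + c * (b - a)) (\<lambda>a b c. \<kappa> * (b - c) + (b - a)) a b c
      (mat_ideal A (Pt \<kappa>))"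
proof -
  define p0 p1 r0 r1 where "p0 = A$1$1" and "p1 = A$2$1" and "r0 = A$1$2" and "r1 = A$2$2"
  note entries = p0_def[symmetric] p1_def[symmetric] r0_def[symmetric] r1_def[symmetric]
  have d: "p0 * r1 - p1 * r0 = 1"
    using det by (simp add: det_2 entries mult.commute)
  have a: "a = ext_quot p0 p1" "a = ext_quot (- p0) (- p1)"
    by (simp_all add: a_def entries ext_quot_minus)
  have b: "b = ext_quot (r0 - p0) (r1 - p1)"
    by (simp add: b_def entries)
  have c: "c = ext_quot r0 r1" "c = ext_quot (- r0) (- r1)"
    by (simp_all add: c_def entries ext_quot_minus)
  \<comment> \<open>With \<open>p\<close> and \<open>r\<close> the columns of \<open>A\<close>, the
    vectors \<open>p\<close>, \<open>r - p\<close>, \<open>r\<close> represent \<open>a\<close>,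
    \<open>b\<close>, \<open>c\<close>. In each of \<open>(p, r - p, r)\<close>,
    \<open>(r - p, - r, - p)\<close> and \<open>(r, - p, r - p)\<close> the third vector is the sum
    of the first two.\<close>
  have nz: "p0 * (r1 - p1) - p1 * (r0 - p0) \<noteq> 0" "(r0 - p0) * - r1 - (r1 - p1) * - r0 \<noteq> 0"
      "r0 * - p1 - r1 * - p0 \<noteq> 0"
    using d by (simp_all add: algebra_simps)
  have sums: "x + (y - x) = y" "y - x - y = - x" "x + - y = x - y" for x y :: real
    by simp_all
  have "mat_ideal A (Pt (- (1 + \<kappa>) / \<kappa>)) = ext_quot (p0 - \<kappa> * (r0 - p0)) (p1 - \<kappa> * (r1 - p1))"
  proof -
    \<comment> \<open>Scaling both coordinates by \<open>- \<kappa>\<close> clears the denominator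
      and gives the form of the cross formula.\<close>
    have "- \<kappa> * (x * (- (1 + \<kappa>) / \<kappa>) + y) = x - \<kappa> * (y - x)" for x y
      using pos by (simp add: field_simps)
    then show ?thesis
      using ext_quot_scale[of "- \<kappa>" "p0 * (- (1 + \<kappa>) / \<kappa>) + r0" "p1 * (- (1 + \<kappa>) / \<kappa>) + r1"] pos
      by (simp only: mat_ideal.simps entries)
  qed
  then show "frac_value (\<lambda>a b c. \<kappa> * b * (c - a) + a * (c - b)) (\<lambda>a b c. \<kappa> * (c - a) + (c - b)) a b c
      (mat_ideal A (Pt (- (1 + \<kappa>) / \<kappa>)))"
    using frac_value_cross[OF nz(1) pos]
    by (simp only: a(1) b c(1) sums)
  have "mat_ideal A (Pt (- 1 / (1 + \<kappa>))) = ext_quot (r0 - p0 - \<kappa> * - r0) (r1 - p1 - \<kappa> * - r1)"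
  proof -
    have "(1 + \<kappa>) * (x * (- 1 / (1 + \<kappa>)) + y) = y - x - \<kappa> * - y" for x y
      using pos by (simp add: field_simps)
    then show ?thesis
      using ext_quot_scale[of "1 + \<kappa>" "p0 * (- 1 / (1 + \<kappa>)) + r0" "p1 * (- 1 / (1 + \<kappa>)) + r1"] pos
      by (simp only: mat_ideal.simps entries)
  qed
  then have "frac_value (\<lambda>b c a. \<kappa> * c * (a - b) + b * (a - c)) (\<lambda>b c a. \<kappa> * (a - b) + (a - c)) b c a
      (mat_ideal A (Pt (- 1 / (1 + \<kappa>))))"
    using frac_value_cross[OF nz(2) pos]
    by (simp only: a(2) b c(2) sums)
  then show "frac_value (\<lambda>a b c. \<kappa> * c * (a - b) + b * (a - c)) (\<lambda>a b c. \<kappa> * (a - b) + (a - c)) a b c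
      (mat_ideal A (Pt (- 1 / (1 + \<kappa>))))"
    by (subst frac_value_rotate)
  have "mat_ideal A (Pt \<kappa>) = ext_quot (r0 - \<kappa> * - p0) (r1 - \<kappa> * - p1)"
    by (simp add: entries algebra_simps)
  then have "frac_value (\<lambda>c a b. \<kappa> * a * (b - c) + c * (b - a)) (\<lambda>c a b. \<kappa> * (b - c) + (b - a)) c a b
      (mat_ideal A (Pt \<kappa>))"
    using frac_value_cross[OF nz(3) pos]
    by (simp only: a(2) b c(1) sums)
  then show "frac_value (\<lambda>a b c. \<kappa> * a * (b - c) + c * (b - a)) (\<lambda>a b c. \<kappa> * (b - c) + (b - a)) a b c
      (mat_ideal A (Pt \<kappa>))"
    \<comment> \<open>Two shifts turn the order \<open>a, b, c\<close> into
      \<open>c, a, b\<close>.\<close>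
    by (subst frac_value_rotate, subst frac_value_rotate)
qed

subsection \<open>The ping-pong argument\<close>

text \<open>A defining function of side i, positive on the half plane containing the interior of the
  triangle. For the second side it is |z + 1/2|^2 - 1/4.\<close>

definition side_form :: "3 \<Rightarrow> complex \<Rightarrow> real" where
  "side_form i z =
     (if i = 1 then Re z + 1 else if i = 2 then Re z * (Re z + 1) + Im z * Im z else - Re z)"

definition beyond :: "3 \<Rightarrow> complex set" where
  "beyond i = {z \<in> upper_half_plane. side_form i z < 0}"

lemma side0_eq: "side0 i = {z \<in> upper_half_plane. side_form i z = 0}"
proof -
  have "geodesic (Pt (- 1)) (Pt 0) = {z \<in> upper_half_plane. Re z * (Re z + 1) + Im z * Im z = 0}"
    using geodesic_ext_quot[of "-1" 1 0 1]
    by (simp add: ext_quot_def algebra_simps)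
  then show ?thesis
    by (auto simp: side0_def side_form_def)
qed

lemma triangle0_eq: "triangle0 = {z \<in> upper_half_plane. \<forall>i. side_form i z \<ge> 0}"
proof -
  have "1 / 2 \<le> cmod (z + 1 / 2) \<longleftrightarrow> 0 \<le> Re z * (Re z + 1) + Im z * Im z" for z
  proof -
    have "1 / 2 \<le> cmod (z + 1 / 2) \<longleftrightarrow> (1 / 2)\<^sup>2 \<le> (cmod (z + 1 / 2))\<^sup>2"
      by (simp add: abs_le_square_iff[symmetric])
    also have "\<dots> \<longleftrightarrow> 0 \<le> Re z * (Re z + 1) + Im z * Im z"
    proof -
      have "(cmod (z + 1 / 2))\<^sup>2 = (1 / 2)\<^sup>2 + (Re z * (Re z + 1) + Im z * Im z)"
        by (simp only: cmod_power2) (simp add: power2_eq_square algebra_simps)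
      then show ?thesis by simp
    qed
    finally show ?thesis .
  qed
  then show ?thesis
    by (auto simp: triangle0_def side_form_def forall_3)
qed

text \<open>This is the disjointness of the closed half planes beyond the sides. The half disc
  misses the regions Re z \<le> -1 and Re z \<ge> 0 because there \<open>Re z * (Re z + 1)\<close>
  is nonnegative while \<open>Im z\<close> is positive.\<close>

lemma side_form_pos:
  assumes "z \<in> upper_half_plane" "side_form i z \<le> 0" "j \<noteq> i"
  shows "side_form j z > 0"
proof -
  have "Im z * Im z > 0"
    using assms(1) by (simp add: upper_half_plane_def)
  then have "Re z \<le> - 1 \<or> 0 \<le> Re z \<longrightarrow> Re z * (Re z + 1) + Im z * Im z > 0"
    using mult_nonpos_nonpos[of "Re z" "Re z + 1"] mult_nonneg_nonneg[of "Re z" "Re z + 1"]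
    by linarith
  with assms(2,3) show ?thesis
    using exhaust_3[of i] exhaust_3[of j] by (elim disjE; simp add: side_form_def; linarith?)
qed

lemma triangle0_upper: "triangle0 \<subseteq> upper_half_plane"
  by (auto simp: triangle0_eq)

lemma side0_upper: "side0 i \<subseteq> upper_half_plane"
  by (auto simp: side0_eq)

lemma beyond_upper: "beyond i \<subseteq> upper_half_plane"
  by (auto simp: beyond_def)

lemma side0_subset_triangle0: "side0 i \<subseteq> triangle0"
proof
  fix z assume z: "z \<in> side0 i"
  then have "side_form j z \<ge> 0" for j
    using side_form_pos[of z i j] by (cases "j = i") (auto simp: side0_eq)
  with z show "z \<in> triangle0"
    by (auto simp: side0_eq triangle0_eq)
qed

lemma triangle0_interior_point: "\<exists>z\<in>triangle0. \<forall>i. side_form i z > 0"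
  by (rule bexI[of _ "Complex (- 1 / 2) 1"])
    (auto simp: triangle0_eq upper_half_plane_def side_form_def)

lemma side0_nonempty: "side0 i \<noteq> {}"
proof -
  have "Complex (- 1) 1 \<in> side0 1" "Complex (- 1 / 2) (1 / 2) \<in> side0 2" "Complex 0 1 \<in> side0 3"
    by (simp_all add: side0_eq upper_half_plane_def side_form_def)
  then show ?thesis
    using exhaust_3[of i] by auto
qed

lemma side0_inject: "side0 i = side0 j \<longleftrightarrow> i = j"
proof
  assume eq: "side0 i = side0 j"
  obtain z where z: "z \<in> side0 i"
    using side0_nonempty by blast
  moreover have "z \<in> side0 j"
    using z eq by simp
  ultimately show "i = j"
    using side_form_pos[of z i j] by (force simp: side0_eq)
qed simp

text \<open>The factor \<open>1 / sqrt (k$i)\<close> in \<open>iota_mat\<close> cancels, so the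
  involutions act by formulas without square roots.\<close>

lemma mat_plane_scaled_vector:
  assumes "r \<noteq> 0"
  shows "mat_plane (r *\<^sub>R vector [vector [p, q], vector [s, t]]) z =
    (of_real p * z + of_real q) / (of_real s * z + of_real t)"
  using assms mult_divide_mult_cancel_left[of "of_real r" "of_real p * z + of_real q" "of_real s * z + of_real t"]
  by (simp add: mat_plane_def moebius_def algebra_simps)

section \<open>The three involutions and the half planes they exchange\<close>

locale weierstrass =
  fixes k :: "real^3"
  assumes k_pos: "k$i > 0"
begin

lemma det_iota_mat: "det (iota_mat k i) = 1"
  using k_pos[of 1] k_pos[of 2] k_pos[of 3] exhaust_3[of i]
  by (auto simp: iota_mat_def det_2 field_simps)

lemma iota_carrier: "iota k i \<in> carrier PSL2R"
  by (simp add: iota_def psl_in_carrier det_iota_mat)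

lemma iota_square: "iota k i \<otimes>\<^bsub>PSL2R\<^esub> iota k i = \<one>\<^bsub>PSL2R\<^esub>"
proof -
  \<comment> \<open>Trace zero and determinant one give this square by Cayley-Hamilton.\<close>
  have "iota_mat k i ** iota_mat k i = - mat 1"
    using k_pos[of 1] k_pos[of 2] k_pos[of 3] exhaust_3[of i]
    by (auto simp: vec_eq_iff forall_2 matrix_mult_2 iota_mat_def mat_1_2 field_simps)
  then show ?thesis
    by (simp add: iota_def psl_mult det_iota_mat one_PSL2R psl_minus)
qed

lemma inv_iota: "inv\<^bsub>PSL2R\<^esub> (iota k i) = iota k i"
  by (rule PSL2R.inv_equality) (simp_all add: iota_carrier iota_square)

text \<open>A half-turn about a point of side i exchanges the two half planes. The negative factor,
  which may depend on \<open>z\<close>, gives both this exchange and the invariance of the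
  side.\<close>

lemma side_form_iota:
  assumes "z \<in> upper_half_plane"
  shows "\<exists>m>0. side_form i (act_plane (iota k i) z) = - m * side_form i z"
proof -
  have Im: "Im z > 0"
    using assms by (simp add: upper_half_plane_def)
  have pos: "k$i > 0"
    by (rule k_pos)
  consider "i = 1" | "i = 2" | "i = 3"
    using exhaust_3 by blast
  then show ?thesis
  proof cases
    case 1
    have nz: "z + 1 \<noteq> 0" "complex_of_real (k$1) \<noteq> 0"
      using Im pos 1 by (auto simp: complex_eq_iff)
    have "act_plane (iota k 1) z = (of_real (k$1) * z + of_real (1 + k$1)) / (of_real (- k$1) * z + of_real (- k$1))"
      unfolding iota_def act_plane_psl iota_mat_def using pos 1
      by (simp only: mat_plane_scaled_vector) (simp add: mat_plane_scaled_vector del: of_real_add)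
    \<comment> \<open>In the coordinate u = z + 1 the involution is u -> -1/(k1 u).\<close>
    also have "\<dots> = - 1 - inverse (z + 1) / of_real (k$1)"
    proof -
      define u where "u = z + 1"
      then have z: "z = u - 1" and "u \<noteq> 0" using nz by simp_all
      have "of_real (k$1) * z + of_real (1 + k$1) = of_real (k$1) * u + 1"
          "of_real (- k$1) * z + of_real (- k$1) = - (of_real (k$1) * u)"
        by (simp_all add: z algebra_simps)
      moreover have "(of_real (k$1) * u + 1) / - (of_real (k$1) * u) = - 1 - inverse u / of_real (k$1)"
        using nz(2) \<open>u \<noteq> 0\<close> by (simp add: field_simps)
      ultimately show ?thesis by (simp only: u_def)
    qed
    finally have eq: "act_plane (iota k 1) z = - 1 - inverse (z + 1) / of_real (k$1)" .
    have "Re (z + 1) / (cmod (z + 1))\<^sup>2 = Re (inverse (z + 1))"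
      by (simp add: cmod_power2)
    then have "side_form 1 (act_plane (iota k 1) z) = - (1 / (k$1 * (cmod (z + 1))\<^sup>2)) * side_form 1 z"
      unfolding eq by (auto simp: side_form_def Re_divide_of_real)
    moreover have "1 / (k$1 * (cmod (z + 1))\<^sup>2) > 0"
      using nz pos 1 by simp
    ultimately show ?thesis
      unfolding 1 by blast
  next
    case 2
    define d where "d = of_real (- (k$2 + 1)) * z + of_real (- 1)"
    have "d \<noteq> 0"
      using Im pos 2 by (auto simp: d_def complex_eq_iff)
    have eq: "act_plane (iota k 2) z = (of_real 1 * z + of_real 1) / d"
      unfolding iota_def act_plane_psl iota_mat_def d_def using pos 2
      by (simp add: mat_plane_scaled_vector del: of_real_add of_real_1 of_real_minus)
    have form: "Re w * (Re w + 1) + Im w * Im w = Re (w * cnj (w + 1))" for w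
      by (simp add: algebra_simps)
    \<comment> \<open>Up to the factor \<open>- k$2\<close> and the common denominator
      \<open>d\<close>, the involution exchanges \<open>z\<close> and \<open>z + 1\<close>; the form
      Re (w cnj (w + 1)) is therefore reproduced with a negative factor.\<close>
    have "act_plane (iota k 2) z + 1 = - of_real (k$2) * z / d"
      using \<open>d \<noteq> 0\<close> unfolding eq by (simp add: field_simps) (simp add: d_def algebra_simps)
    then have "act_plane (iota k 2) z * cnj (act_plane (iota k 2) z + 1) =
        (of_real (- k$2) * ((z + 1) * cnj z)) / of_real ((cmod d)\<^sup>2)"
      unfolding eq complex_norm_square by simp
    then have "side_form 2 (act_plane (iota k 2) z) = Re (of_real (- k$2) * ((z + 1) * cnj z)) / (cmod d)\<^sup>2"
      unfolding side_form_def by (simp only: form Re_divide_of_real) simp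
    also have "\<dots> = - (k$2 / (cmod d)\<^sup>2) * side_form 2 z"
    proof -
      have "Re (of_real (- k$2) * ((z + 1) * cnj z)) = - k$2 * side_form 2 z"
        by (simp add: side_form_def algebra_simps)
      then show ?thesis by simp
    qed
    finally have "side_form 2 (act_plane (iota k 2) z) = - (k$2 / (cmod d)\<^sup>2) * side_form 2 z" .
    moreover have "k$2 / (cmod d)\<^sup>2 > 0"
      using \<open>d \<noteq> 0\<close> pos 2 by simp
    ultimately show ?thesis
      unfolding 2 by blast
  next
    case 3
    have "z \<noteq> 0" using Im by auto
    have "act_plane (iota k 3) z = (of_real 0 * z + of_real (k$3)) / (of_real (- 1) * z + of_real 0)"
      unfolding iota_def act_plane_psl iota_mat_def using pos 3
      by (simp add: mat_plane_scaled_vector del: of_real_0 of_real_1 of_real_minus)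
    then have eq: "act_plane (iota k 3) z = - of_real (k$3) * inverse z"
      by (simp add: field_simps)
    have "Re z / (cmod z)\<^sup>2 = Re (inverse z)"
      by (simp add: cmod_power2)
    then have "side_form 3 (act_plane (iota k 3) z) = - (k$3 / (cmod z)\<^sup>2) * side_form 3 z"
      unfolding eq by (auto simp: side_form_def)
    moreover have "k$3 / (cmod z)\<^sup>2 > 0"
      using \<open>z \<noteq> 0\<close> pos 3 by simp
    ultimately show ?thesis
      unfolding 3 by blast
  qed
qed

lemma translate_iota_beyond:
  assumes "S \<subseteq> upper_half_plane" "\<And>z. z \<in> S \<Longrightarrow> side_form i z > 0"
  shows "translate (iota k i) S \<subseteq> beyond i"
proof -
  have "side_form i (act_plane (iota k i) z) < 0" if "z \<in> S" for z
  proof -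
    have "z \<in> upper_half_plane" "side_form i z > 0"
      using assms that by auto
    moreover from this(1) obtain m where "m > 0" "side_form i (act_plane (iota k i) z) = - m * side_form i z"
      using side_form_iota by blast
    ultimately show ?thesis by simp
  qed
  with assms(1) show ?thesis
    by (auto simp: translate_def beyond_def act_plane_upper iota_carrier)
qed

text \<open>The zero set of the form is mapped into itself, and applying the involution once more
  turns the inclusion into equality.\<close>

lemma translate_iota_side0: "translate (iota k i) (side0 i) = side0 i"
proof -
  have sub: "translate (iota k i) (side0 i) \<subseteq> side0 i"
  proof -
    have "side_form i (act_plane (iota k i) z) = 0" if "z \<in> side0 i" for z
      using that side_form_iota[of z i] by (auto simp: side0_eq)
    then show ?thesis
      using side0_upper by (auto simp: translate_def side0_eq act_plane_upper iota_carrier)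
  qed
  have "side0 i = translate (iota k i) (translate (iota k i) (side0 i))"
    by (simp add: iota_carrier side0_upper iota_square translate_one flip: translate_mult)
  also have "\<dots> \<subseteq> translate (iota k i) (side0 i)"
    using sub by (auto simp: translate_def)
  finally show ?thesis using sub by blast
qed

text \<open>Points of the triangle on side i stay on that side; all others are thrown strictly
  beyond it.\<close>

lemma translate_iota_triangle0: "translate (iota k i) triangle0 \<subseteq> beyond i \<union> side0 i"
proof -
  have "triangle0 \<subseteq> {z \<in> triangle0. side_form i z > 0} \<union> side0 i"
    by (force simp: triangle0_eq side0_eq order.order_iff_strict)
  then have "translate (iota k i) triangle0 \<subseteq>
      translate (iota k i) {z \<in> triangle0. side_form i z > 0} \<union> translate (iota k i) (side0 i)"
    by (auto simp: translate_def)
  moreover have "translate (iota k i) {z \<in> triangle0. side_form i z > 0} \<subseteq> beyond i"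
    using triangle0_upper by (intro translate_iota_beyond) auto
  ultimately show ?thesis
    using translate_iota_side0 by blast
qed

section \<open>Reduced words acting on the fundamental triangle\<close>

lemma word_value_simps [simp]:
  "word_value k [] = \<one>\<^bsub>PSL2R\<^esub>" "word_value k (i # w) = iota k i \<otimes>\<^bsub>PSL2R\<^esub> word_value k w"
  by (simp_all add: word_value_def)

lemma word_value_carrier: "word_value k w \<in> carrier PSL2R"
  by (induction w) (simp_all add: iota_carrier)

text \<open>Ping-pong induction, started at two letters: a single letter leaves its own side in
  place, but the closed half plane beyond j lies strictly on the near side of i for j different from
  i, so the next letter moves everything strictly beyond.\<close>

lemma reduced_word_beyond:
  assumes "distinct_adj (i # j # w)"
  shows "translate (word_value k (i # j # w)) triangle0 \<subseteq> beyond i"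
  using assms
proof (induction w arbitrary: i j)
  case Nil
  then have "i \<noteq> j" by simp
  have "side_form i z > 0" if "z \<in> beyond j \<union> side0 j" for z
    using that side_form_pos[of z j i] \<open>i \<noteq> j\<close> by (auto simp: beyond_def side0_eq)
  then have "translate (iota k i) (beyond j \<union> side0 j) \<subseteq> beyond i"
    using beyond_upper side0_upper by (intro translate_iota_beyond) blast+
  moreover have "translate (word_value k [i, j]) triangle0 = translate (iota k i) (translate (iota k j) triangle0)"
    by (simp add: iota_carrier translate_mult triangle0_upper)
  ultimately show ?case
    using image_mono[OF translate_iota_triangle0[of j], of "act_plane (iota k i)"]
    unfolding translate_def by blast
next
  case (Cons l w)
  then have "i \<noteq> j" and IH: "translate (word_value k (j # l # w)) triangle0 \<subseteq> beyond j"
    by simp_all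
  have "translate (iota k i) (beyond j) \<subseteq> beyond i"
    using beyond_upper side_form_pos[of _ j i] \<open>i \<noteq> j\<close>
    by (intro translate_iota_beyond) (auto simp: beyond_def)
  moreover have "translate (word_value k (i # j # l # w)) triangle0 =
      translate (iota k i) (translate (word_value k (j # l # w)) triangle0)"
    unfolding word_value_simps(2)[of i]
    by (intro translate_mult iota_carrier word_value_carrier triangle0_upper)
  ultimately show ?case
    using IH by (fastforce simp: translate_def)
qed

lemma reduced_word_translate:
  assumes "distinct_adj (i # w)"
  shows "translate (word_value k (i # w)) triangle0 \<subseteq> beyond i \<union> side0 i"
proof (cases w)
  case Nil
  then show ?thesis
    using translate_iota_triangle0 by (simp add: iota_carrier)
next
  case (Cons j w')
  then show ?thesis
    using reduced_word_beyond assms by blast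
qed

text \<open>A nonempty reduced word moves the triangle into a closed half plane that misses its
  interior.\<close>

lemma reduced_word_triangle0:
  assumes "distinct_adj w" "translate (word_value k w) triangle0 = triangle0"
  shows "w = []"
proof (cases w)
  case (Cons i w')
  then have "triangle0 \<subseteq> beyond i \<union> side0 i"
    using reduced_word_translate assms by metis
  moreover obtain z where "z \<in> triangle0" "side_form i z > 0"
    using triangle0_interior_point by blast
  ultimately show ?thesis
    by (auto simp: beyond_def side0_eq)
qed

lemma reduced_word_side0:
  assumes "distinct_adj w" "side0 i = translate (word_value k w) (side0 j)"
  shows "i = j \<and> (w = [] \<or> w = [i])"
proof -
  have sub: "side0 i \<subseteq> translate (word_value k w) triangle0"
    unfolding assms(2) using side0_subset_triangle0[of j] by (auto simp: translate_def)
  obtain z where z: "z \<in> side0 i"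
    using side0_nonempty by blast
  show ?thesis
  \<comment> \<open>This rule splits by length zero, one and at least two, as the ping-pong bounds
    require.\<close>
  proof (cases w rule: remdups_adj.cases)
    case 1
    then show ?thesis
      using assms by (simp add: translate_one side0_inject)
  next
    case (2 l)
    then have "z \<in> beyond l \<union> side0 l"
      using z sub translate_iota_triangle0[of l] by (auto simp: iota_carrier)
    then have "l = i"
      using z side_form_pos[of z l i] by (force simp: beyond_def side0_eq)
    have "translate (iota k i) (side0 i) = translate (iota k i) (side0 j)"
    proof -
      have "word_value k w = iota k i"
        using 2 \<open>l = i\<close> by (simp add: iota_carrier)
      then show ?thesis
        using assms(2) translate_iota_side0 by metis
    qed
    then have "i = j"
      by (simp add: translate_inject iota_carrier side0_upper side0_inject)
    with 2 \<open>l = i\<close> show ?thesis by simp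
  next
    case (3 l m w')
    then have "z \<in> beyond l"
      using z sub reduced_word_beyond[of l m w'] assms(1) by blast
    \<comment> \<open>The i-th side is not strictly beyond any side: its form is \<open>0\<close>
      for \<open>l = i\<close> and positive otherwise.\<close>
    then have False
      using z side_form_pos[of z l i] by (cases "l = i") (auto simp: beyond_def side0_eq)
    then show ?thesis ..
  qed
qed

section \<open>The group as the set of values of reduced words\<close>

lemma word_value_append: "word_value k (v @ w) = word_value k v \<otimes>\<^bsub>PSL2R\<^esub> word_value k w"
  by (induction v) (simp_all add: iota_carrier word_value_carrier PSL2R.m_assoc)

text \<open>A letter put in front of a reduced word either cancels an equal first letter or keeps
  the word reduced.\<close>

lemma reduced_word_exists: "\<exists>v. distinct_adj v \<and> word_value k v = word_value k w"
proof (induction w)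
  case Nil
  show ?case by (rule exI[of _ "[]"]) simp
next
  case (Cons i w)
  then obtain v where v: "distinct_adj v" "word_value k v = word_value k w"
    by blast
  show ?case
  proof (cases "v \<noteq> [] \<and> hd v = i")
    case True
    then obtain v' where v': "v = i # v'"
      by (cases v) auto
    then have "word_value k (i # w) = word_value k v'"
      using v(2) by (simp add: iota_carrier word_value_carrier iota_square flip: PSL2R.m_assoc v(2))
    then show ?thesis
      using v v' distinct_adj_ConsD by metis
  next
    case False
    then have "distinct_adj (i # v)" "word_value k (i # v) = word_value k (i # w)"
      using v by (auto simp: distinct_adj_Cons)
    then show ?thesis by blast
  qed
qed

text \<open>The generators are their own inverses, so products of generators exhaust the group, and
  every word can be reduced.\<close>

lemma weierstrass_group_eq: "weierstrass_group k = word_value k ` {w. distinct_adj w}"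
proof
  have "\<exists>w. h = word_value k w" if "h \<in> weierstrass_group k" for h
    using that unfolding weierstrass_group_def
  proof (induction rule: generate.induct)
    case one
    show ?case by (rule exI[of _ "[]"]) simp
  next
    case (incl h)
    then obtain i where "h = iota k i" by blast
    then have "h = word_value k [i]" by (simp add: iota_carrier)
    then show ?case by blast
  next
    case (inv h)
    then obtain i where "h = iota k i" by blast
    then have "inv\<^bsub>PSL2R\<^esub> h = word_value k [i]" by (simp add: iota_carrier inv_iota)
    then show ?case by blast
  next
    case (eng h h')
    then show ?case by (metis word_value_append)
  qed
  then show "weierstrass_group k \<subseteq> word_value k ` {w. distinct_adj w}"
    using reduced_word_exists by (metis (mono_tags, lifting) image_eqI mem_Collect_eq subsetI)
  have "word_value k w \<in> weierstrass_group k" for w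
    unfolding weierstrass_group_def by (induction w) (auto intro: generate.intros)
  then show "word_value k ` {w. distinct_adj w} \<subseteq> weierstrass_group k"
    by blast
qed

lemma subgroup_weierstrass_group: "subgroup (weierstrass_group k) PSL2R"
  unfolding weierstrass_group_def by (rule PSL2R.generate_is_subgroup) (auto simp: iota_carrier)

lemmas weierstrass_carrier = subgroup.mem_carrier[OF subgroup_weierstrass_group]
lemmas weierstrass_mult = subgroup.m_closed[OF subgroup_weierstrass_group]
lemmas weierstrass_inv = subgroup.m_inv_closed[OF subgroup_weierstrass_group]

lemma iota_in_weierstrass_group: "iota k i \<in> weierstrass_group k"
  unfolding weierstrass_group_def by (auto intro: generate.incl)

text \<open>Comparing the translates by \<open>g\<close> and \<open>h\<close> reduces to comparing
  the base figure with its translate by a reduced word.\<close>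

lemma weierstrass_group_relative_word:
  assumes "g \<in> weierstrass_group k" "h \<in> weierstrass_group k"
  obtains w where "distinct_adj w" "h = g \<otimes>\<^bsub>PSL2R\<^esub> word_value k w"
proof -
  have "inv\<^bsub>PSL2R\<^esub> g \<otimes>\<^bsub>PSL2R\<^esub> h \<in> weierstrass_group k"
    by (intro weierstrass_mult weierstrass_inv assms)
  then obtain w where w: "distinct_adj w" "inv\<^bsub>PSL2R\<^esub> g \<otimes>\<^bsub>PSL2R\<^esub> h = word_value k w"
    by (auto simp: weierstrass_group_eq)
  have "g \<in> carrier PSL2R" "h \<in> carrier PSL2R"
    using assms by (simp_all add: weierstrass_carrier)
  then have "h = g \<otimes>\<^bsub>PSL2R\<^esub> (inv\<^bsub>PSL2R\<^esub> g \<otimes>\<^bsub>PSL2R\<^esub> h)"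
    by (simp flip: PSL2R.m_assoc)
  with w that show ?thesis by simp
qed

text \<open>The stabiliser of the fundamental triangle is trivial by ping-pong. This makes the
  description in \<open>vertices\<close> unique.\<close>

lemma translate_triangle0_inject:
  assumes "g \<in> weierstrass_group k" "h \<in> weierstrass_group k"
  shows "translate g triangle0 = translate h triangle0 \<longleftrightarrow> g = h"
proof
  assume eq: "translate g triangle0 = translate h triangle0"
  obtain w where w: "distinct_adj w" "h = g \<otimes>\<^bsub>PSL2R\<^esub> word_value k w"
    using weierstrass_group_relative_word[OF assms] .
  have g: "g \<in> carrier PSL2R"
    using assms(1) by (rule weierstrass_carrier)
  have "triangle0 = translate (word_value k w) triangle0"
    using eq by (simp add: w(2) g translate_mult translate_inject translate_upper word_value_carrier triangle0_upper)
  then have "w = []"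
    using reduced_word_triangle0[OF w(1)] by simp
  then show "g = h"
    by (simp add: w(2) g)
qed simp

text \<open>Each side thus carries one mark only and belongs to no triangles other than the two
  exchanged by its half-turn.\<close>

lemma translate_side0_eqD:
  assumes "g \<in> weierstrass_group k" "h \<in> weierstrass_group k"
    and eq: "translate g (side0 i) = translate h (side0 j)"
  shows "i = j \<and> (h = g \<or> h = g \<otimes>\<^bsub>PSL2R\<^esub> iota k i)"
proof -
  obtain w where w: "distinct_adj w" "h = g \<otimes>\<^bsub>PSL2R\<^esub> word_value k w"
    using weierstrass_group_relative_word[OF assms(1,2)] .
  have g: "g \<in> carrier PSL2R"
    using assms(1) by (rule weierstrass_carrier)
  have "side0 i = translate (word_value k w) (side0 j)"
    using eq by (simp add: w(2) g translate_mult translate_inject translate_upper word_value_carrier side0_upper)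
  then have "i = j" "w = [] \<or> w = [i]"
    using reduced_word_side0[OF w(1)] by auto
  then show ?thesis
    using g by (auto simp: w(2) iota_carrier)
qed

lemma iota_inject: "iota k i = iota k j \<longleftrightarrow> i = j"
proof
  assume "iota k i = iota k j"
  \<comment> \<open>Equal generators multiply to the identity, whereas a reduced word of length two
    moves the triangle.\<close>
  then have "translate (word_value k [i, j]) triangle0 = triangle0"
    by (simp add: iota_carrier iota_square translate_one)
  then show "i = j"
    using reduced_word_triangle0[of "[i, j]"] by auto
qed simp

lemma iota_not_one: "iota k i \<noteq> \<one>\<^bsub>PSL2R\<^esub>"
proof
  assume "iota k i = \<one>\<^bsub>PSL2R\<^esub>"
  then have "translate (word_value k [i]) triangle0 = triangle0"
    by (simp add: translate_one)
  then show False
    using reduced_word_triangle0[of "[i]"] by auto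
qed

subsection \<open>Adjacent triangles\<close>

lemma sides_translate:
  assumes "g \<in> weierstrass_group k"
  shows "sides k (translate g triangle0) = range (\<lambda>i. translate g (side0 i))"
  using assms translate_triangle0_inject by (fastforce simp: sides_def)

lemma vertices_translate:
  assumes "g \<in> weierstrass_group k"
  shows "vertices k (translate g triangle0) =
    (act_ideal g Infty, act_ideal g (Pt (- 1)), act_ideal g (Pt 0))"
proof -
  have "(THE h. h \<in> weierstrass_group k \<and> translate g triangle0 = translate h triangle0) = g"
    by (rule the_equality) (use assms translate_triangle0_inject in auto)
  then show ?thesis by (simp add: vertices_def)
qed

lemma translate_iota_mult_side0:
  assumes "g \<in> carrier PSL2R"
  shows "translate (g \<otimes>\<^bsub>PSL2R\<^esub> iota k i) (side0 i) = translate g (side0 i)"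
  using assms by (simp add: translate_mult iota_carrier side0_upper translate_iota_side0)

text \<open>Each half-turn swaps the ends of its own side; the image of the opposite vertex is the
  new vertex of the neighbour.\<close>

lemma act_ideal_iota:
  "act_ideal (iota k 1) Infty = Pt (- 1)"
  "act_ideal (iota k 1) (Pt (- 1)) = Infty"
  "act_ideal (iota k 1) (Pt 0) = Pt (- (1 + k$1) / k$1)"
  "act_ideal (iota k 2) Infty = Pt (- 1 / (1 + k$2))"
  "act_ideal (iota k 2) (Pt (- 1)) = Pt 0"
  "act_ideal (iota k 2) (Pt 0) = Pt (- 1)"
  "act_ideal (iota k 3) Infty = Pt 0"
  "act_ideal (iota k 3) (Pt (- 1)) = Pt (k$3)"
  "act_ideal (iota k 3) (Pt 0) = Infty"
  using k_pos[of 1] k_pos[of 2] k_pos[of 3]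
  by (simp_all add: iota_def act_ideal_psl iota_mat_def ext_quot_def field_simps)

lemma adjacent_across_iff:
  assumes g: "g \<in> weierstrass_group k"
  shows "adjacent_across k i (translate g triangle0) T \<longleftrightarrow>
    T = translate (g \<otimes>\<^bsub>PSL2R\<^esub> iota k i) triangle0"
proof
  assume adj: "adjacent_across k i (translate g triangle0) T"
  then obtain h where h: "h \<in> weierstrass_group k" "T = translate h triangle0"
    by (auto simp: adjacent_across_def triangulation_def)
  obtain s where "s \<in> sides k (translate g triangle0)" "s \<in> sides k T" "marked k s i"
    using adj by (auto simp: adjacent_across_def)
  then obtain j l f where s: "s = translate g (side0 j)" "s = translate h (side0 l)"
      and f: "f \<in> weierstrass_group k" "s = translate f (side0 i)"
    unfolding h(2) sides_translate[OF g] sides_translate[OF h(1)] marked_def by blast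
  \<comment> \<open>The mark is witnessed by an unrelated element \<open>f\<close>, but the side
    determines its label.\<close>
  have "j = i"
    using translate_side0_eqD[OF g f(1)] s f by metis
  moreover have "h \<noteq> g"
    using adj h by (auto simp: adjacent_across_def)
  ultimately have "h = g \<otimes>\<^bsub>PSL2R\<^esub> iota k i"
    using translate_side0_eqD[OF g h(1)] s by metis
  then show "T = translate (g \<otimes>\<^bsub>PSL2R\<^esub> iota k i) triangle0"
    using h by simp
next
  let ?h = "g \<otimes>\<^bsub>PSL2R\<^esub> iota k i"
  assume T: "T = translate ?h triangle0"
  have h: "?h \<in> weierstrass_group k"
    using g iota_in_weierstrass_group weierstrass_mult by blast
  have "?h \<noteq> g"
    using g iota_not_one PSL2R.l_cancel_one' iota_carrier weierstrass_carrier by metis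
  then have "translate g triangle0 \<noteq> T"
    unfolding T using g h translate_triangle0_inject by metis
  moreover have "translate g (side0 i) \<in> sides k T"
    unfolding T sides_translate[OF h]
    using translate_iota_mult_side0[of g i] g weierstrass_carrier by blast
  ultimately show "adjacent_across k i (translate g triangle0) T"
    unfolding adjacent_across_def triangulation_def marked_def using T g h
    by (auto simp: sides_translate)
qed

lemma common_sides:
  assumes g: "g \<in> weierstrass_group k"
  shows "sides k (translate g triangle0) \<inter> sides k (translate (g \<otimes>\<^bsub>PSL2R\<^esub> iota k i) triangle0) =
    {translate g (side0 i)}"
proof -
  let ?h = "g \<otimes>\<^bsub>PSL2R\<^esub> iota k i"
  have carr: "g \<in> carrier PSL2R" using g weierstrass_carrier by blast
  have h: "?h \<in> weierstrass_group k"
    using g iota_in_weierstrass_group weierstrass_mult by blast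
  have "j = i" if "translate g (side0 j) = translate ?h (side0 l)" for j l
  proof -
    \<comment> \<open>Cancelling \<open>g\<close> leaves the i-th involution equal to the identity,
      which is impossible, or to the j-th one.\<close>
    have "?h = g \<or> ?h = g \<otimes>\<^bsub>PSL2R\<^esub> iota k j"
      using translate_side0_eqD[OF g h that] by blast
    then show ?thesis
      using carr iota_not_one iota_inject iota_carrier PSL2R.l_cancel_one' PSL2R.l_cancel by metis
  qed
  then show ?thesis
    using translate_iota_mult_side0[OF carr, of i]
    by (auto simp: sides_translate[OF g] sides_translate[OF h])
qed

end

theorem theorem1p1:
  fixes k :: "real^3" and g :: "(real^2^2) set" and n :: nat and a b c :: ideal_point
  assumes "k$1 > 0" and "k$2 > 0" and "k$3 > 0" and "k$1 * k$2 * k$3 = 1"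
    and "g \<in> weierstrass_group k" and "has_reduced_length k g n"
    and "a = act_ideal g Infty" and "b = act_ideal g (Pt (- 1))" and "c = act_ideal g (Pt 0)"
  shows "\<exists>T1 T2 T3.
     (\<forall>T. adjacent_across k 1 (translate g triangle0) T \<longleftrightarrow> T = T1) \<and>
     (\<forall>T. adjacent_across k 2 (translate g triangle0) T \<longleftrightarrow> T = T2) \<and>
     (\<forall>T. adjacent_across k 3 (translate g triangle0) T \<longleftrightarrow> T = T3) \<and>
     sides k (translate g triangle0) \<inter> sides k T1 = {geodesic a b} \<and>
     sides k (translate g triangle0) \<inter> sides k T2 = {geodesic b c} \<and>
     sides k (translate g triangle0) \<inter> sides k T3 = {geodesic c a} \<and>
     (\<exists>v. frac_value (\<lambda>a b c. k$1 * b * (c - a) + a * (c - b))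
                     (\<lambda>a b c. k$1 * (c - a) + (c - b)) a b c v \<and>
          vertices k T1 = (b, a, v)) \<and>
     (\<exists>v. frac_value (\<lambda>a b c. k$2 * c * (a - b) + b * (a - c))
                     (\<lambda>a b c. k$2 * (a - b) + (a - c)) a b c v \<and>
          vertices k T2 = (v, c, b)) \<and>
     (\<exists>v. frac_value (\<lambda>a b c. k$3 * a * (b - c) + c * (b - a))
                     (\<lambda>a b c. k$3 * (b - c) + (b - a)) a b c v \<and>
          vertices k T3 = (c, v, a))"
proof -
  have "k$i > 0" for i
    using assms(1-3) exhaust_3[of i] by auto
  then interpret weierstrass k
    by unfold_locales
  note g = \<open>g \<in> weierstrass_group k\<close>
  have carr: "g \<in> carrier PSL2R"
    using g by (rule weierstrass_carrier)
  then obtain A where A: "det A = 1" "g = psl A"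
    by (auto simp: carrier_PSL2R)
  define T where "T i = translate (g \<otimes>\<^bsub>PSL2R\<^esub> iota k i) triangle0" for i
  have adj: "adjacent_across k i (translate g triangle0) S \<longleftrightarrow> S = T i" for i S
    unfolding T_def by (rule adjacent_across_iff[OF g])
  have "sides k (translate g triangle0) \<inter> sides k (T i) = {translate g (side0 i)}" for i
    unfolding T_def by (rule common_sides[OF g])
  then have sides: "sides k (translate g triangle0) \<inter> sides k (T 1) = {geodesic a b}"
      "sides k (translate g triangle0) \<inter> sides k (T 2) = {geodesic b c}"
      "sides k (translate g triangle0) \<inter> sides k (T 3) = {geodesic c a}"
    by (simp_all add: side0_def translate_geodesic[OF carr] assms del: geodesic.simps)
  \<comment> \<open>The half-turn acts on the base vertices before \<open>g\<close>: two of them are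
    interchanged, and the third goes to the point handled by
    \<open>frac_value_adjacent\<close>.\<close>
  have "vertices k (T i) = (act_ideal g (act_ideal (iota k i) Infty),
      act_ideal g (act_ideal (iota k i) (Pt (- 1))), act_ideal g (act_ideal (iota k i) (Pt 0)))" for i
    using vertices_translate[OF weierstrass_mult[OF g iota_in_weierstrass_group]]
    by (simp add: T_def act_ideal_mult carr iota_carrier)
  then have vertices: "vertices k (T 1) = (b, a, mat_ideal A (Pt (- (1 + k$1) / k$1)))"
      "vertices k (T 2) = (mat_ideal A (Pt (- 1 / (1 + k$2))), c, b)"
      "vertices k (T 3) = (c, mat_ideal A (Pt (k$3)), a)"
    by (simp_all only: act_ideal_iota assms A(2) act_ideal_psl)
  have abc: "a = mat_ideal A Infty" "b = mat_ideal A (Pt (- 1))" "c = mat_ideal A (Pt 0)"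
    by (simp_all only: assms A(2) act_ideal_psl)
  show ?thesis
    by (intro exI[of _ "T 1"] exI[of _ "T 2"] exI[of _ "T 3"] conjI allI adj sides
        exI[of _ "mat_ideal A (Pt (- (1 + k$1) / k$1))"] exI[of _ "mat_ideal A (Pt (- 1 / (1 + k$2)))"]
        exI[of _ "mat_ideal A (Pt (k$3))"] vertices)
      (unfold abc, (rule frac_value_adjacent A(1) k_pos)+)
qed

end
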